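(* Let $n\ge1$, $0<\alpha<2$, and let $G\in C^1(\mathbb{R})$ satisfy $G(0)=0$ and $G'(t)\ge c_0>0$ for all $t\in\mathbb{R}$. Assume that $u\in C^{1,1}_{loc}(\mathbb{R}^n)\cap L_\alpha$ is a positive solution of $$F_\alpha(u(x))=g(u(x)),\qquad x\in\mathbb{R}^n,$$ where $g$ is a differentiable function. Suppose that for some $\gamma>0$, $$u(x)=o\Big(\frac{1}{|x|^\gamma}\Big)\quad\text{as }|x|\to\infty,$$ and that $$g'(s)\le s^q\ \text{ for all } s>0,\quad\text{with } q\gamma\ge\alpha.$$ Then $u$ must be radially symmetric about some point in $\mathbb{R}^n$.
   Context: For $0<\alpha<2$, $$F_\alpha(u(x)) = C_{n,\alpha}\lim_{\epsilon\to0}\int_{\mathbb{R}^n\setminus B_\epsilon(x)}\frac{G(u(x)-u(z))}{|x-z|^{n+\alpha}}\,dz,$$ where $C_{n,\alpha}>0$ is a constant depending only on $n$ and $\alpha$; the equation presupposes that this limit exists and is finite at each $x\in\mathbb{R}^n$. The space $L_\alpha$ is $$L_\alpha=\Big\{u\in L^1_{loc}(\mathbb{R}^n)\ :\ \int_{\mathbb{R}^n}\frac{|u(x)|}{1+|x|^{n+\alpha}}\,dx<\infty\Big\}.$$ A function $u$ is radially symmetric about $p\in\mathbb{R}^n$ if $u(x)$ depends only on $|x-p|$. *)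

theory Defs
  imports "HOL-Analysis.Analysis" "HOL-Library.Landau_Symbols"
begin

text \<open>
  \<open>\<real>\<^sup>n\<close> is \<^typ>\<open>real ^ 'n\<close> with \<open>n = CARD('n) \<ge> 1\<close>.
\<close>

definition C11_loc :: "(real ^ 'n \<Rightarrow> real) \<Rightarrow> bool" where
  "C11_loc u \<longleftrightarrow>
     (\<exists>D :: real ^ 'n \<Rightarrow> real ^ 'n.
        (\<forall>x. (u has_derivative (\<lambda>h. D x \<bullet> h)) (at x)) \<and>
        (\<forall>K. compact K \<longrightarrow> (\<exists>L. L-lipschitz_on K D)))"

definition L1_loc :: "(real ^ 'n \<Rightarrow> real) set" where
  "L1_loc = {u. \<forall>K. compact K \<longrightarrow> set_integrable lebesgue K u}"

definition L_space :: "real \<Rightarrow> (real ^ 'n \<Rightarrow> real) set" where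
  "L_space \<alpha> = {u \<in> L1_loc.
     integrable lebesgue (\<lambda>x. \<bar>u x\<bar> / (1 + norm x powr (real CARD('n) + \<alpha>)))}"

definition F_kernel ::
    "(real \<Rightarrow> real) \<Rightarrow> real \<Rightarrow> (real ^ 'n \<Rightarrow> real) \<Rightarrow> real ^ 'n \<Rightarrow> real ^ 'n \<Rightarrow> real" where
  "F_kernel G \<alpha> u x z = G (u x - u z) / norm (x - z) powr (real CARD('n) + \<alpha>)"

definition F_truncated ::
    "(real \<Rightarrow> real) \<Rightarrow> real \<Rightarrow> (real ^ 'n \<Rightarrow> real) \<Rightarrow> real ^ 'n \<Rightarrow> real \<Rightarrow> real" where
  "F_truncated G \<alpha> u x \<epsilon> = (LINT z:(UNIV - ball x \<epsilon>)|lebesgue. F_kernel G \<alpha> u x z)"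

text \<open>
  Integrals of non-integrable functions and limits of divergent families have junk values, so
  the well-definedness of the principal value is a predicate of its own. The factor \<open>C\<close> is the
  normalising constant \<open>C\<^bsub>n,\<alpha>\<^esub> > 0\<close>, whose value is left open.
\<close>

definition F_op_exists ::
    "(real \<Rightarrow> real) \<Rightarrow> real \<Rightarrow> (real ^ 'n \<Rightarrow> real) \<Rightarrow> real ^ 'n \<Rightarrow> bool" where
  "F_op_exists G \<alpha> u x \<longleftrightarrow>
     (\<forall>\<epsilon>>0. set_integrable lebesgue (UNIV - ball x \<epsilon>) (F_kernel G \<alpha> u x)) \<and>
     (\<exists>l. (F_truncated G \<alpha> u x \<longlongrightarrow> l) (at_right 0))"

definition F_op ::
    "real \<Rightarrow> (real \<Rightarrow> real) \<Rightarrow> real \<Rightarrow> (real ^ 'n \<Rightarrow> real) \<Rightarrow> real ^ 'n \<Rightarrow> real" where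
  "F_op C G \<alpha> u x = C * Lim (at_right 0) (F_truncated G \<alpha> u x)"

definition radially_symmetric_about :: "(real ^ 'n \<Rightarrow> real) \<Rightarrow> real ^ 'n \<Rightarrow> bool" where
  "radially_symmetric_about u p \<longleftrightarrow> (\<exists>\<phi> :: real \<Rightarrow> real. \<forall>x. u x = \<phi> (norm (x - p)))"

end

theory Submission
  imports Defs
begin

text \<open>
  The proof is the direct method of moving planes. For a unit vector \<open>e\<close> put
  \<open>w(x) = u(x') - u(x)\<close>, with \<open>x'\<close> the reflection of \<open>x\<close> in the plane \<open>{z. z \<bullet> e = l}\<close>.
  If \<open>w\<close> attains a negative minimum over the half-space \<open>{z. z \<bullet> e \<le> l}\<close> at \<open>x\<close>, at distance
  \<open>d\<close> from the plane, then folding the integral onto the half-space and using \<open>G' \<ge> c\<^sub>0\<close> shows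
  that the operator at \<open>x'\<close> minus the operator at \<open>x\<close> is at most \<open>\<kappa> * w(x) / d powr \<alpha>\<close> with
  \<open>\<kappa> > 0\<close>; by the equation it is at least \<open>w(x) * u(x) powr q\<close>. Hence
  \<open>\<kappa> \<le> u(x) powr q * d powr \<alpha>\<close>. This one inequality excludes minima far away (by the decay
  of \<open>u\<close>) as well as minima close to the plane, so that no boundary point lemma is needed: at
  the supremum of all \<open>l\<close> with \<open>w \<ge> 0\<close> on the half-space, \<open>w\<close> vanishes, since otherwise it is
  positive by the strong maximum principle, while negative minima for slightly larger \<open>l\<close>
  accumulate at an interior point. So \<open>u\<close> is symmetric about a plane orthogonal to each
  direction, and these planes have a common point because \<open>u\<close> is not periodic.
\<close>

subsection \<open>Reflections preserve Lebesgue measure\<close>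

text \<open>The library's change of variables needs a well-ordered index type, hence this detour: by
  Vitali's theorem an open set is, up to a null set, a disjoint union of balls, and isometries map
  balls to balls of the same radius.\<close>

lemma isometry_involution_emeasure_le:
  fixes R :: "'a::euclidean_space \<Rightarrow> 'a"
  assumes iso: "\<And>x y. dist (R x) (R y) = dist x y" and inv: "\<And>x. R (R x) = x" and "open U"
  shows "emeasure lebesgue (R -` U) \<le> emeasure lebesgue U"
proof -
  define K where "K = {i. 0 < snd i \<and> ball (fst i) (snd i) \<subseteq> U}"
  obtain C where C: "countable C" "C \<subseteq> K"
     "pairwise (\<lambda>i j. disjnt (ball (fst i) (snd i)) (ball (fst j) (snd j))) C"
     "negligible (U - (\<Union>i\<in>C. ball (fst i) (snd i)))"
  proof (rule Vitali_covering_theorem_balls[of U K fst snd])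
    fix x :: 'a and d :: real assume "x \<in> U" "0 < d"
    then obtain e where e: "e > 0" "ball x e \<subseteq> U" using \<open>open U\<close> openE by blast
    have "ball x (min e (d/2)) \<subseteq> U" using e by auto
    then show "\<exists>i. i \<in> K \<and> x \<in> ball (fst i) (snd i) \<and> snd i < d"
      using e \<open>0 < d\<close> by (intro exI[of _ "(x, min e (d/2))"]) (auto simp: K_def)
  qed blast
  let ?N = "U - (\<Union>i\<in>C. ball (fst i) (snd i))"
  have vball: "R -` ball a r = ball (R a) r" for a r
    using iso[of a] iso[of "R a"] inv by auto
  have vim: "R -` A = R ` A" for A using inv by (auto simp: image_iff) metis
  \<comment> \<open>An isometry is Lipschitz with constant 1, so the null set left over by the
    Vitali cover stays null.\<close>
  have "negligible (R ` ?N)"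
  proof (rule negligible_locally_Lipschitz_image[OF order_refl C(4)])
    fix x assume "x \<in> ?N"
    show "\<exists>T B. open T \<and> x \<in> T \<and> (\<forall>y \<in> ?N \<inter> T. norm (R y - R x) \<le> B * norm (y - x))"
      by (rule exI[of _ UNIV], rule exI[of _ 1]) (use iso in \<open>auto simp: dist_norm\<close>)
  qed
  then have null: "R -` ?N \<in> null_sets lebesgue"
    by (simp add: vim negligible_iff_null_sets)
  have disj: "disjoint_family_on (\<lambda>i. ball (fst i) (snd i)) C"
    using C(3) by (auto simp: disjoint_family_on_def pairwise_def disjnt_def)
  then have disj': "disjoint_family_on (\<lambda>i. ball (R (fst i)) (snd i)) C"
    unfolding disjoint_family_on_def vball[symmetric] by blast
  have "open (\<Union>i\<in>C. ball (R (fst i)) (snd i))" by auto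
  then have meas: "(\<Union>i\<in>C. ball (R (fst i)) (snd i)) \<in> sets lebesgue" by simp
  have "emeasure lebesgue (R -` U)
      \<le> emeasure lebesgue ((\<Union>i\<in>C. ball (R (fst i)) (snd i)) \<union> R -` ?N)"
  proof (rule emeasure_mono)
    show "R -` U \<subseteq> (\<Union>i\<in>C. ball (R (fst i)) (snd i)) \<union> R -` ?N"
      by (auto simp: vball[symmetric])
  qed (use null meas in auto)
  also have "\<dots> = emeasure lebesgue (\<Union>i\<in>C. ball (R (fst i)) (snd i))"
    by (rule emeasure_Un_null_set) (use null meas in auto)
  also have "\<dots> = (\<integral>\<^sup>+i. emeasure lebesgue (ball (R (fst i)) (snd i)) \<partial>count_space C)"
    by (rule emeasure_UN_countable) (use C disj' in auto)
  also have "\<dots> = (\<integral>\<^sup>+i. emeasure lebesgue (ball (fst i) (snd i)) \<partial>count_space C)"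
    by (rule nn_integral_cong) (use C K_def in \<open>auto simp: emeasure_ball\<close>)
  also have "\<dots> = emeasure lebesgue (\<Union>i\<in>C. ball (fst i) (snd i))"
    by (rule emeasure_UN_countable[symmetric]) (use C disj in auto)
  also have "\<dots> \<le> emeasure lebesgue U"
    by (rule emeasure_mono) (use C \<open>open U\<close> K_def in auto)
  finally show ?thesis .
qed

text \<open>The inequality for a box and for its preimage gives equality, because \<open>R\<close>
  is an involution. Boxes determine the Borel measure, and the result passes to the
  completion.\<close>

lemma
  fixes R :: "'a::euclidean_space \<Rightarrow> 'a"
  assumes iso: "\<And>x y. dist (R x) (R y) = dist x y" and inv: "\<And>x. R (R x) = x"
  shows distr_lebesgue_isometry_involution: "distr lebesgue lebesgue R = lebesgue"
    and measurable_lebesgue_isometry_involution: "R \<in> lebesgue \<rightarrow>\<^sub>M lebesgue"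
proof -
  have cont: "continuous_on UNIV R"
    unfolding continuous_on_iff using iso by metis
  then have R[measurable]: "R \<in> borel_measurable borel"
    by (rule borel_measurable_continuous_onI)
  have vim: "R -` R -` A = A" for A using inv by auto
  have eq: "lborel = distr lborel borel R"
  proof (rule lborel_eqI)
    fix l u :: 'a assume lu: "\<And>b. b \<in> Basis \<Longrightarrow> l \<bullet> b \<le> u \<bullet> b"
    have o: "open (R -` box l u)"
      by (rule open_vimage[OF open_box cont])
    have "emeasure lebesgue (R -` box l u) = emeasure lebesgue (box l u)"
      using isometry_involution_emeasure_le[OF iso inv open_box, of l u]
        isometry_involution_emeasure_le[OF iso inv o] by (simp add: vim antisym)
    then show "emeasure (distr lborel borel R) (box l u) = (\<Prod>b\<in>Basis. (u - l) \<bullet> b)"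
      using lu o by (simp add: emeasure_distr emeasure_lborel_box_eq)
  qed auto
  have eq': "distr lborel lborel R = lborel"
    using eq by (metis distr_cong sets_lborel)
  show "distr lebesgue lebesgue R = lebesgue"
    by (subst completion.completion_distr_eq[symmetric])
       (auto simp: eq' distr_completion measurable_completion)
  show "R \<in> lebesgue \<rightarrow>\<^sub>M lebesgue"
    by (rule completion.measurable_completion2)
       (auto simp: eq' distr_completion measurable_completion)
qed

section \<open>Reflection in a hyperplane: distances and integrals\<close>

definition reflect :: "'a::real_inner \<Rightarrow> real \<Rightarrow> 'a \<Rightarrow> 'a" where
  "reflect e l x = x - (2 * (x \<bullet> e - l)) *\<^sub>R e"

lemma inner_unit: "norm e = 1 \<Longrightarrow> e \<bullet> e = (1::real)"
  by (simp add: norm_eq_1)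

lemma inner_reflect: "norm e = 1 \<Longrightarrow> reflect e l x \<bullet> e = 2 * l - x \<bullet> e"
  by (simp add: reflect_def inner_diff_left inner_unit)

lemma reflect_reflect: "norm e = 1 \<Longrightarrow> reflect e l (reflect e l x) = x"
  using inner_reflect[of e l x] by (simp add: reflect_def algebra_simps flip: scaleR_add_left)

lemma reflect_fixed: "x \<bullet> e = l \<Longrightarrow> reflect e l x = x"
  by (simp add: reflect_def)

text \<open>Comparisons of distances on one side of the plane rest on this identity: the added
  product is nonnegative when \<open>x\<close> and \<open>z\<close> lie on the same side.\<close>

lemma norm_diff_reflect_sq:
  assumes "norm e = 1"
  shows "(norm (x - reflect e l z))\<^sup>2 = (norm (x - z))\<^sup>2 + 4 * (l - x \<bullet> e) * (l - z \<bullet> e)"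
  unfolding reflect_def power2_norm_eq_inner using inner_unit[OF assms]
  by (simp add: inner_diff_left inner_diff_right inner_commute algebra_simps)

lemma dist_reflect:
  assumes "norm e = 1"
  shows "dist (reflect e l x) (reflect e l y) = dist x y"
proof -
  have "(norm (reflect e l x - reflect e l y))\<^sup>2 = (norm (x - y))\<^sup>2"
    \<comment> \<open>Reflecting changes the sign of \<open>l - x \<bullet> e\<close>, so the
      product terms of the two instances cancel.\<close>
    using norm_diff_reflect_sq[OF assms, of "reflect e l x" l y] norm_diff_reflect_sq[OF assms, of y l x]
      inner_reflect[OF assms, of l x]
    by (simp add: norm_minus_commute algebra_simps)
  then show ?thesis by (simp add: dist_norm)
qed

lemma norm_diff_reflect:
  assumes "norm e = 1"
  shows "norm (reflect e l x - z) = norm (x - reflect e l z)"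
  using dist_reflect[OF assms, of l x "reflect e l z"] by (simp add: reflect_reflect[OF assms] dist_norm)

lemma norm_le_norm_diff_reflect:
  assumes "norm e = 1" "x \<bullet> e \<le> l" "z \<bullet> e \<le> l"
  shows "norm (x - z) \<le> norm (x - reflect e l z)"
proof -
  have "(norm (x - z))\<^sup>2 \<le> (norm (x - reflect e l z))\<^sup>2"
    using assms by (simp add: norm_diff_reflect_sq)
  then show ?thesis by (simp add: power2_le_iff_abs_le)
qed

lemma norm_diff_reflect_less:
  assumes "norm e = 1" "x \<bullet> e < l" "z \<bullet> e < l"
  shows "norm (x - z) < norm (x - reflect e l z)"
proof -
  have "(norm (x - z))\<^sup>2 < (norm (x - reflect e l z))\<^sup>2"
    using assms by (simp add: norm_diff_reflect_sq)
  then show ?thesis by (rule power_less_imp_less_base) simp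
qed

text \<open>For \<open>x\<close> before the plane, a reflected point lies across it. This keeps
  reflected points away from the singularity of the kernel at \<open>x\<close>.\<close>

lemma le_norm_diff_reflect:
  assumes "norm e = 1" "z \<bullet> e \<le> l"
  shows "l - x \<bullet> e \<le> norm (x - reflect e l z)"
proof -
  have "l - x \<bullet> e \<le> (reflect e l z - x) \<bullet> e"
    using inner_reflect[OF assms(1), of l z] assms(2) by (simp add: inner_diff_left)
  also have "\<dots> \<le> norm (reflect e l z - x)"
    using norm_cauchy_schwarz[of "reflect e l z - x" e] assms(1) by simp
  finally show ?thesis by (simp add: norm_minus_commute)
qed

lemma continuous_on_reflect [continuous_intros]:
  "continuous_on S f \<Longrightarrow> continuous_on S g \<Longrightarrow> continuous_on S (\<lambda>x. reflect e (f x) (g x))"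
  unfolding reflect_def by (intro continuous_intros)

lemma
  fixes f :: "'a::euclidean_space \<Rightarrow> real"
  assumes e: "norm e = 1" and f: "integrable lebesgue f"
  shows integrable_reflect_lebesgue: "integrable lebesgue (\<lambda>x. f (reflect e l x))"
    and integral_reflect_lebesgue: "integral\<^sup>L lebesgue (\<lambda>x. f (reflect e l x)) = integral\<^sup>L lebesgue f"
proof -
  note R = measurable_lebesgue_isometry_involution[of "reflect e l", OF dist_reflect[OF e] reflect_reflect[OF e]]
  note D = distr_lebesgue_isometry_involution[of "reflect e l", OF dist_reflect[OF e] reflect_reflect[OF e]]
  have fm: "f \<in> borel_measurable lebesgue" using f by simp
  show "integrable lebesgue (\<lambda>x. f (reflect e l x))"
    using integrable_distr_eq[OF R fm] f D by simp
  show "integral\<^sup>L lebesgue (\<lambda>x. f (reflect e l x)) = integral\<^sup>L lebesgue f"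
    using integral_distr[OF R fm] D by simp
qed

subsection \<open>Comparison of the operator at reflected points\<close>

locale fully_nonlinear_solution =
  fixes u :: "real ^ 'n \<Rightarrow> real"
    and G g :: "real \<Rightarrow> real"
    and \<alpha> c\<^sub>0 C \<gamma> q :: real
  assumes \<alpha>: "0 < \<alpha>" and C: "0 < C"
    and G_C1: "G C1_differentiable_on UNIV"
    and c\<^sub>0: "0 < c\<^sub>0" and deriv_G: "\<And>t. deriv G t \<ge> c\<^sub>0"
    and u_C11: "C11_loc u"
    and u_pos: "\<And>x. 0 < u x"
    and F_exists: "\<And>x. F_op_exists G \<alpha> u x"
    and F_eq: "\<And>x. F_op C G \<alpha> u x = g (u x)"
    and g_diff: "g differentiable_on {0<..}"
    and \<gamma>: "0 < \<gamma>"
    and u_decay: "u \<in> o[at_infinity](\<lambda>x. 1 / norm x powr \<gamma>)"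
    and deriv_g: "\<And>s. 0 < s \<Longrightarrow> deriv g s \<le> s powr q"
    and q: "q * \<gamma> \<ge> \<alpha>"
begin


lemma exponent_pos: "0 < real CARD('n) + \<alpha>" using \<alpha> by simp

lemma q_pos: "0 < q"
  using q \<alpha> \<gamma> by (smt (verit) mult_nonpos_nonneg)

lemma continuous_u: "continuous_on S u"
  using u_C11 unfolding C11_loc_def
  by (meson continuous_at_imp_continuous_on has_derivative_continuous)

lemma G_has_derivative: "(G has_real_derivative deriv G t) (at t)"
proof -
  obtain D where "\<And>x. (G has_vector_derivative D x) (at x)"
    using G_C1 unfolding C1_differentiable_on_def by auto
  then show ?thesis
    by (metis DERIV_imp_deriv has_real_derivative_iff_has_vector_derivative)
qed

lemma continuous_G: "continuous_on S G"
  using G_has_derivative by (meson DERIV_isCont continuous_at_imp_continuous_on)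

text \<open>The lower bound on the derivative of \<open>G\<close> enters the argument through this
  inequality, as uniform ellipticity.\<close>

lemma G_mean_value_le:
  assumes "a \<le> b"
  shows "G a - G b \<le> c\<^sub>0 * (a - b)"
proof (cases "a = b")
  case False
  then have "a < b" using assms by simp
  then obtain z where "G b - G a = (b - a) * deriv G z"
    using MVT2[of a b G "deriv G"] G_has_derivative by blast
  moreover have "(b - a) * c\<^sub>0 \<le> (b - a) * deriv G z"
    using \<open>a < b\<close> deriv_G by (intro mult_left_mono) auto
  ultimately show ?thesis by (simp add: algebra_simps)
qed simp

lemma G_less: "a < b \<Longrightarrow> G a < G b"
  using G_mean_value_le[of a b] c\<^sub>0 mult_pos_neg[of c\<^sub>0 "a - b"] by simp

lemma G_le: "a \<le> b \<Longrightarrow> G a \<le> G b"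
  using G_less[of a b] by (cases "a = b") auto

text \<open>The mean value point lies below \<open>b\<close>, and \<open>s powr q\<close> increases
  because \<open>q\<close> is positive. With \<open>a\<close> and \<open>b\<close> the values of
  \<open>u\<close> at a reflected point and at the point itself, this is how the growth condition on
  \<open>g\<close> is used.\<close>

lemma g_diff_le:
  assumes "0 < a" "a \<le> b"
  shows "g b - g a \<le> (b - a) * b powr q"
proof (cases "a = b")
  case False
  then have "a < b" using assms by simp
  have "(g has_real_derivative deriv g x) (at x)" if "a \<le> x" for x
  proof -
    have "g differentiable at x"
      using g_diff that assms by (auto simp: differentiable_on_eq_differentiable_at)
    then show ?thesis
      by (metis DERIV_deriv_iff_real_differentiable)
  qed
  then obtain z where z: "a < z" "z < b" "g b - g a = (b - a) * deriv g z"
    using MVT2[of a b g "deriv g"] \<open>a < b\<close> by blast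
  have "deriv g z \<le> b powr q"
    using deriv_g[of z] z assms q_pos powr_mono2[of q z b] by linarith
  then show ?thesis
    using z \<open>a < b\<close> by (auto intro: mult_left_mono)
qed simp

lemma F_tendsto: "((\<lambda>\<epsilon>. C * F_truncated G \<alpha> u x \<epsilon>) \<longlongrightarrow> F_op C G \<alpha> u x) (at_right 0)"
proof -
  obtain l where l: "(F_truncated G \<alpha> u x \<longlongrightarrow> l) (at_right 0)"
    using F_exists[of x] unfolding F_op_exists_def by blast
  then have "Lim (at_right 0) (F_truncated G \<alpha> u x) = l"
    by (intro tendsto_Lim) auto
  then show ?thesis
    unfolding F_op_def using l by (auto intro: tendsto_intros)
qed

section \<open>Pointwise comparison of the integrands\<close>

definition w :: "real ^ 'n \<Rightarrow> real \<Rightarrow> real ^ 'n \<Rightarrow> real" where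
  "w e l x = u (reflect e l x) - u x"

text \<open>Numerator of the difference of the two integrands after the variable of the integral at
  \<open>reflect e l x\<close> is reflected; the denominators then agree, the reflection being an
  isometry.\<close>

definition G_diff :: "real ^ 'n \<Rightarrow> real \<Rightarrow> real ^ 'n \<Rightarrow> real ^ 'n \<Rightarrow> real" where
  "G_diff e l x z = G (u (reflect e l x) - u (reflect e l z)) - G (u x - u z)"

lemma G_diff_nonpos: "w e l x \<le> w e l z \<Longrightarrow> G_diff e l x z \<le> 0"
  unfolding G_diff_def w_def by (simp add: G_le)

text \<open>Pairing the arguments of \<open>G\<close> crosswise makes both differences have increment \<open>w e l x\<close>.\<close>

lemma G_diff_add_le:
  assumes "norm e = 1" "w e l x \<le> 0"
  shows "G_diff e l x z + G_diff e l x (reflect e l z) \<le> 2 * c\<^sub>0 * w e l x"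
proof -
  let ?R = "reflect e l"
  have "G (u (?R x) - u (?R z)) - G (u x - u (?R z)) \<le> c\<^sub>0 * w e l x"
       "G (u (?R x) - u z) - G (u x - u z) \<le> c\<^sub>0 * w e l x"
    using assms(2) G_mean_value_le[of "u (?R x) - u (?R z)" "u x - u (?R z)"]
      G_mean_value_le[of "u (?R x) - u z" "u x - u z"] by (auto simp: w_def)
  then show ?thesis
    using assms(1) by (simp add: G_diff_def reflect_reflect)
qed

text \<open>At \<open>z = x\<close> the value is \<open>0\<close>, by division by zero, which is why
  the comparison of kernels assumes \<open>x \<noteq> z\<close>.\<close>

definition kernel :: "real ^ 'n \<Rightarrow> real ^ 'n \<Rightarrow> real" where
  "kernel x z = 1 / norm (x - z) powr (real CARD('n) + \<alpha>)"

lemma kernel_nonneg: "0 \<le> kernel x z" by (simp add: kernel_def)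

lemma kernel_reflect_le:
  assumes "norm e = 1" "x \<bullet> e \<le> l" "z \<bullet> e \<le> l" "x \<noteq> z"
  shows "kernel x (reflect e l z) \<le> kernel x z"
  unfolding kernel_def using norm_le_norm_diff_reflect[OF assms(1-3)] assms(4) exponent_pos
  by (intro divide_left_mono powr_mono2 mult_pos_pos) auto

text \<open>The numerator at \<open>z\<close> is nonpositive and carries the larger kernel. Lowering
  that kernel to the one at the reflected point leaves a common factor, and the bound for the sum of
  the numerators applies.\<close>

lemma kernel_sum_le:
  assumes e: "norm e = 1" and "x \<bullet> e \<le> l" "z \<bullet> e \<le> l" "x \<noteq> z"
    and wx: "w e l x \<le> 0" and le: "w e l x \<le> w e l z"
  shows "G_diff e l x z * kernel x z + G_diff e l x (reflect e l z) * kernel x (reflect e l z)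
    \<le> 2 * c\<^sub>0 * w e l x * kernel x (reflect e l z)"
proof -
  have "G_diff e l x z * kernel x z \<le> G_diff e l x z * kernel x (reflect e l z)"
    using G_diff_nonpos[OF le] kernel_reflect_le[OF assms(1-4)] by (intro mult_left_mono_neg) auto
  moreover have "(G_diff e l x z + G_diff e l x (reflect e l z)) * kernel x (reflect e l z)
      \<le> 2 * c\<^sub>0 * w e l x * kernel x (reflect e l z)"
    by (intro mult_right_mono G_diff_add_le[OF e wx] kernel_nonneg)
  ultimately show ?thesis by (simp add: distrib_right)
qed

text \<open>Points are paired with their reflections. A pair contributes at most \<open>- D\<close>
  on the ball around \<open>y\<^sub>0\<close> and at most \<open>0\<close> elsewhere, except that on
  \<open>ball x \<epsilon>\<close> truncation removes one partner; the other is bounded by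
  \<open>M\<close>.\<close>

lemma integral_difference_le:
  assumes e: "norm e = 1" and \<epsilon>: "0 < \<epsilon>" "\<epsilon> \<le> l - x \<bullet> e" "\<epsilon> \<le> s"
    and wx: "w e l x \<le> 0" and min: "\<And>z. z \<bullet> e \<le> l \<Longrightarrow> w e l x \<le> w e l z"
    and Y: "ball y\<^sub>0 r \<inter> ball x s = {}" "ball y\<^sub>0 r \<subseteq> {z. z \<bullet> e < l}"
    and D: "\<And>y. y \<in> ball y\<^sub>0 r \<Longrightarrow>
      G_diff e l x y * kernel x y + G_diff e l x (reflect e l y) * kernel x (reflect e l y) \<le> - D"
    and M: "0 \<le> M" "\<And>z. z \<in> ball x \<epsilon> \<Longrightarrow> G_diff e l x (reflect e l z) * kernel x (reflect e l z) \<le> M"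
  shows "F_truncated G \<alpha> u (reflect e l x) \<epsilon> - F_truncated G \<alpha> u x \<epsilon>
    \<le> M * measure lebesgue (ball x \<epsilon>) - D * measure lebesgue (ball y\<^sub>0 r)"
proof -
  let ?R = "reflect e l"
  define f1 where "f1 z = indicator (UNIV - ball (?R x) \<epsilon>) z *\<^sub>R F_kernel G \<alpha> u (?R x) z" for z
  define f2 where "f2 z = indicator (UNIV - ball x \<epsilon>) z *\<^sub>R F_kernel G \<alpha> u x z" for z
  define h where "h z = f1 (?R z) - f2 z" for z
  \<comment> \<open>Pairwise majorant of \<open>h\<close>: the truncation error minus the
    gain.\<close>
  define \<phi> where "\<phi> z = M * indicator (ball x \<epsilon>) z - D * indicator (ball y\<^sub>0 r) z" for z
  have xl: "x \<bullet> e < l" using \<epsilon> by simp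
  have int1: "integrable lebesgue f1" and int2: "integrable lebesgue f2"
    using F_exists \<epsilon>(1) unfolding F_op_exists_def f1_def f2_def set_integrable_def by blast+
  have inth: "integrable lebesgue h"
    unfolding h_def using int1 int2 integrable_reflect_lebesgue[OF e int1]
    by (intro Bochner_Integration.integrable_diff) auto
  have ball: "integrable lebesgue (indicat_real (ball a b))" for a :: "real ^ 'n" and b
    using lmeasurable_ball[of a b] lmeasurable_iff_integrable by blast
  have int\<phi>: "integrable lebesgue \<phi>"
    unfolding \<phi>_def
    by (rule Bochner_Integration.integrable_diff; rule integrable_mult_right; rule ball)
  \<comment> \<open>The ball removed around the reflected point is the mirror image of
    \<open>ball x \<epsilon>\<close>, so one indicator serves both terms.\<close>
  have h_eq: "h z = indicator (UNIV - ball x \<epsilon>) z * (G_diff e l x z * kernel x z)" for z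
  proof -
    have "?R z \<in> ball (?R x) \<epsilon> \<longleftrightarrow> z \<in> ball x \<epsilon>"
      by (simp add: dist_reflect[OF e])
    moreover have "norm (?R x - ?R z) = norm (x - z)"
      using dist_reflect[OF e, of l x z] by (simp add: dist_norm)
    ultimately show ?thesis
      unfolding h_def f1_def f2_def F_kernel_def G_diff_def kernel_def
      by (auto simp: indicator_def diff_divide_distrib)
  qed
  have half: "h z + h (?R z) \<le> \<phi> z + \<phi> (?R z)" if zl: "z \<bullet> e \<le> l" for z
  proof -
    have far: "?R z \<notin> ball x \<epsilon>"
      using le_norm_diff_reflect[OF e zl, of x] \<epsilon> by (simp add: dist_norm)
    have "?R z \<notin> ball y\<^sub>0 r \<or> ?R z = z"
      using Y(2) zl inner_reflect[OF e, of l z] reflect_fixed[of z e l] by (cases "z \<bullet> e = l") auto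
    moreover have "z \<notin> ball y\<^sub>0 r" if "z \<bullet> e = l" using that Y(2) by auto
    moreover have "?R z = z \<Longrightarrow> z \<bullet> e = l" using inner_reflect[OF e, of l z] by simp
    ultimately have farY: "?R z \<notin> ball y\<^sub>0 r" by metis
    show ?thesis
    proof (cases "z \<in> ball x \<epsilon>")
      case True
      then have "z \<in> ball x s" using \<epsilon>(3) by auto
      then have "z \<notin> ball y\<^sub>0 r" using Y(1) by blast
      then show ?thesis
        using True far farY M(2)[OF True] by (simp add: h_eq \<phi>_def)
    next
      case False
      have nz: "x \<noteq> z" using False \<epsilon>(1) by auto
      have eq: "h z + h (?R z) = G_diff e l x z * kernel x z + G_diff e l x (?R z) * kernel x (?R z)"
        using False far by (simp add: h_eq)
      show ?thesis
      proof (cases "z \<in> ball y\<^sub>0 r")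
        case True
        then show ?thesis using False far farY D[OF True] eq by (simp add: \<phi>_def)
      next
        case nY: False
        have "2 * c\<^sub>0 * w e l x * kernel x (?R z) \<le> 0"
          using c\<^sub>0 wx kernel_nonneg by (simp add: mult_nonneg_nonpos mult_nonpos_nonneg)
        then have "h z + h (?R z) \<le> 0"
          unfolding eq using kernel_sum_le[OF e _ zl nz wx min[OF zl]] xl by simp
        then show ?thesis using False far farY nY by (simp add: \<phi>_def)
      qed
    qed
  qed
  have all: "h z + h (?R z) \<le> \<phi> z + \<phi> (?R z)" for z
  proof (cases "z \<bullet> e \<le> l")
    case False
    then have "?R z \<bullet> e \<le> l" using inner_reflect[OF e, of l z] by simp
    from half[OF this] show ?thesis by (simp add: reflect_reflect[OF e])
  qed (rule half)
  \<comment> \<open>Folding onto the half-space is replaced by symmetrising over the whole space, at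
    the price of a factor 2.\<close>
  have sym: "(\<integral>z. f z + f (?R z) \<partial>lebesgue) = 2 * (\<integral>z. f z \<partial>lebesgue)"
    if "integrable lebesgue f" for f :: "real ^ 'n \<Rightarrow> real"
    using integrable_reflect_lebesgue[OF e that] integral_reflect_lebesgue[OF e that] that by simp
  have "2 * (\<integral>z. h z \<partial>lebesgue) \<le> 2 * (\<integral>z. \<phi> z \<partial>lebesgue)"
    unfolding sym[OF inth, symmetric] sym[OF int\<phi>, symmetric]
    using inth int\<phi> integrable_reflect_lebesgue[OF e inth] integrable_reflect_lebesgue[OF e int\<phi>] all
    by (intro integral_mono Bochner_Integration.integrable_add) auto
  moreover have "(\<integral>z. h z \<partial>lebesgue) = F_truncated G \<alpha> u (?R x) \<epsilon> - F_truncated G \<alpha> u x \<epsilon>"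
    unfolding h_def F_truncated_def set_lebesgue_integral_def f1_def[symmetric] f2_def[symmetric]
    using int1 int2 integrable_reflect_lebesgue[OF e int1] integral_reflect_lebesgue[OF e int1]
    by simp
  moreover have "(\<integral>z. \<phi> z \<partial>lebesgue)
      = M * measure lebesgue (ball x \<epsilon>) - D * measure lebesgue (ball y\<^sub>0 r)"
    unfolding \<phi>_def by (subst Bochner_Integration.integral_diff) (simp_all add: ball)
  ultimately show ?thesis by simp
qed

text \<open>In the limit of vanishing truncation radius the error, a fixed \<open>M\<close> times
  the volume of a shrinking ball, disappears and only the gain remains.\<close>

lemma F_difference_le:
  assumes e: "norm e = 1" and xl: "x \<bullet> e < l" and "0 < s"
    and wx: "w e l x \<le> 0" and min: "\<And>z. z \<bullet> e \<le> l \<Longrightarrow> w e l x \<le> w e l z"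
    and Y: "ball y\<^sub>0 r \<inter> ball x s = {}" "ball y\<^sub>0 r \<subseteq> {z. z \<bullet> e < l}"
    and D: "\<And>y. y \<in> ball y\<^sub>0 r \<Longrightarrow>
      G_diff e l x y * kernel x y + G_diff e l x (reflect e l y) * kernel x (reflect e l y) \<le> - D"
  shows "g (u (reflect e l x)) - g (u x) \<le> - (C * (D * measure lebesgue (ball y\<^sub>0 r)))"
proof -
  let ?R = "reflect e l"
  define d where "d = l - x \<bullet> e"
  have d: "0 < d" using xl by (simp add: d_def)
  \<comment> \<open>Compactness bounds the numerator, and reflected points keep distance
    \<open>d\<close> from \<open>x\<close>; hence \<open>M\<close> is independent of the truncation
    radius.\<close>
  have "continuous_on (cball x d) (\<lambda>z. G_diff e l x (?R z))"
    unfolding G_diff_def reflect_reflect[OF e]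
    by (intro continuous_intros continuous_on_compose2[OF continuous_G[of UNIV]]
        continuous_on_compose2[OF continuous_u[of UNIV]]) auto
  then have "bounded ((\<lambda>z. G_diff e l x (?R z)) ` cball x d)"
    by (intro compact_imp_bounded compact_continuous_image) auto
  then obtain B where B: "0 < B" "\<And>z. z \<in> cball x d \<Longrightarrow> \<bar>G_diff e l x (?R z)\<bar> \<le> B"
    unfolding bounded_pos by auto
  have xz: "z \<bullet> e \<le> l" if "z \<in> ball x d" for z
  proof -
    have "(z - x) \<bullet> e \<le> norm (z - x)"
      using norm_cauchy_schwarz[of "z - x" e] e by simp
    also have "\<dots> < d" using that by (simp add: dist_norm norm_minus_commute)
    finally show ?thesis by (simp add: inner_diff_left d_def)
  qed
  define M where "M = B * (1 / d powr (real CARD('n) + \<alpha>))"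
  have M: "G_diff e l x (?R z) * kernel x (?R z) \<le> M" if "z \<in> ball x d" for z
  proof -
    have "d \<le> norm (x - ?R z)"
      using le_norm_diff_reflect[OF e xz[OF that], of x] by (simp add: d_def)
    then have "kernel x (?R z) \<le> 1 / d powr (real CARD('n) + \<alpha>)"
      unfolding kernel_def using d exponent_pos by (intro divide_left_mono powr_mono2 mult_pos_pos) auto
    moreover have "G_diff e l x (?R z) \<le> B" using B(2)[of z] that by auto
    ultimately show ?thesis
      unfolding M_def using kernel_nonneg B(1) by (intro mult_mono) auto
  qed
  have M0: "0 \<le> M" using B(1) by (simp add: M_def)
  let ?V = "measure lebesgue (ball y\<^sub>0 r)"
  have ev: "eventually (\<lambda>\<epsilon>. C * F_truncated G \<alpha> u (?R x) \<epsilon> - C * F_truncated G \<alpha> u x \<epsilon>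
      \<le> C * (M * measure lebesgue (ball x \<epsilon>) - D * ?V)) (at_right 0)"
    unfolding eventually_at_right_field
  proof (intro exI conjI allI impI)
    show "0 < min d s" using d \<open>0 < s\<close> by simp
    fix \<epsilon> assume \<epsilon>: "0 < \<epsilon>" "\<epsilon> < min d s"
    then have "F_truncated G \<alpha> u (?R x) \<epsilon> - F_truncated G \<alpha> u x \<epsilon>
        \<le> M * measure lebesgue (ball x \<epsilon>) - D * ?V"
      by (intro integral_difference_le[OF e _ _ _ wx min Y D M0 M]) (auto simp: d_def)
    then show "C * F_truncated G \<alpha> u (?R x) \<epsilon> - C * F_truncated G \<alpha> u x \<epsilon>
      \<le> C * (M * measure lebesgue (ball x \<epsilon>) - D * ?V)"
      using C by (simp flip: right_diff_distrib)
  qed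
  have vol: "((\<lambda>\<epsilon>. measure lebesgue (ball x \<epsilon>)) \<longlongrightarrow> 0) (at_right 0)"
  proof (rule Lim_transform_eventually)
    show "eventually (\<lambda>\<epsilon>. unit_ball_vol (real CARD('n)) * \<epsilon> ^ CARD('n) = measure lebesgue (ball x \<epsilon>)) (at_right 0)"
      unfolding eventually_at_right_field by (intro exI[of _ 1]) (simp add: content_ball)
    have "((\<lambda>\<epsilon>. unit_ball_vol (real CARD('n)) * \<epsilon> ^ CARD('n)) \<longlongrightarrow> unit_ball_vol (real CARD('n)) * 0 ^ CARD('n)) (at_right 0)"
      by (intro tendsto_intros)
    then show "((\<lambda>\<epsilon>. unit_ball_vol (real CARD('n)) * \<epsilon> ^ CARD('n)) \<longlongrightarrow> 0) (at_right (0::real))"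
      by (simp add: power_0_left)
  qed
  have "F_op C G \<alpha> u (?R x) - F_op C G \<alpha> u x \<le> C * (M * 0 - D * ?V)"
  proof (rule tendsto_le[OF _ _ _ ev])
    show "((\<lambda>\<epsilon>. C * (M * measure lebesgue (ball x \<epsilon>) - D * ?V)) \<longlongrightarrow> C * (M * 0 - D * ?V)) (at_right 0)"
      by (intro tendsto_intros vol)
  qed (auto intro!: tendsto_intros F_tendsto)
  then show ?thesis by (simp add: F_eq)
qed

subsection \<open>Negative minima and the strong maximum principle\<close>

definition neg_min :: "real ^ 'n \<Rightarrow> real \<Rightarrow> real ^ 'n \<Rightarrow> bool" where
  "neg_min e l x \<longleftrightarrow> x \<bullet> e < l \<and> w e l x < 0 \<and> (\<forall>z. z \<bullet> e \<le> l \<longrightarrow> w e l x \<le> w e l z)"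

text \<open>A ball of radius \<open>d\<close> at distance comparable to \<open>d\<close> yields a
  gain of order \<open>d ^ CARD('n)\<close> over \<open>d powr (CARD('n) + \<alpha>)\<close>, that
  is \<open>d powr (- \<alpha>)\<close>. The constant is uniform in \<open>e\<close>,
  \<open>l\<close> and \<open>x\<close>.\<close>

lemma neg_min_bound:
  obtains \<kappa> where "0 < \<kappa>"
    "\<And>e l x. norm e = 1 \<Longrightarrow> neg_min e l x \<Longrightarrow> \<kappa> \<le> u x powr q * (l - x \<bullet> e) powr \<alpha>"
proof
  let ?p = "real CARD('n) + \<alpha>"
  let ?V = "unit_ball_vol (real CARD('n))"
  let ?\<kappa> = "2 * C * c\<^sub>0 * ?V / 5 powr ?p"
  show "0 < ?\<kappa>" using C c\<^sub>0 by simp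
  fix e l x assume e: "norm e = 1" and nm: "neg_min e l x"
  define d where "d = l - x \<bullet> e"
  have d: "0 < d" and wx: "w e l x < 0" and min: "\<And>z. z \<bullet> e \<le> l \<Longrightarrow> w e l x \<le> w e l z"
    using nm by (auto simp: neg_min_def d_def)
  \<comment> \<open>The ball of radius \<open>d\<close> around this centre avoids
    \<open>ball x d\<close> and stays in the half-space. The centre reflects to distance
    \<open>4 * d\<close> from \<open>x\<close>, so reflected points of the ball are within
    \<open>5 * d\<close>; hence the 5 in the constant.\<close>
  define y\<^sub>0 where "y\<^sub>0 = x - (2 * d) *\<^sub>R e"
  define D where "D = 2 * c\<^sub>0 * (- w e l x) * (1 / (5 * d) powr ?p)"
  have xy: "dist y\<^sub>0 x = 2 * d" using e d by (simp add: y\<^sub>0_def dist_norm)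
  have y\<^sub>0e: "y\<^sub>0 \<bullet> e = l - 3 * d"
    using inner_unit[OF e] by (simp add: y\<^sub>0_def inner_diff_left d_def)
  have ye: "y \<bullet> e < l - d" if "y \<in> ball y\<^sub>0 d" for y
  proof -
    have "(y - y\<^sub>0) \<bullet> e \<le> norm (y - y\<^sub>0)"
      using norm_cauchy_schwarz[of "y - y\<^sub>0" e] e by simp
    moreover have "norm (y - y\<^sub>0) < d"
      using that by (simp add: dist_norm norm_minus_commute)
    ultimately show ?thesis using d by (simp add: y\<^sub>0e inner_diff_left)
  qed
  have "g (u (reflect e l x)) - g (u x) \<le> - (C * (D * measure lebesgue (ball y\<^sub>0 d)))"
  proof (rule F_difference_le[OF e _ d _ min])
    show "ball y\<^sub>0 d \<inter> ball x d = {}"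
      using xy by (metis add.right_neutral disjoint_ballI mult_2 order_refl)
    show "ball y\<^sub>0 d \<subseteq> {z. z \<bullet> e < l}" using ye d by force
    fix y assume y: "y \<in> ball y\<^sub>0 d"
    have "(6 * d) *\<^sub>R e = (2 * d) *\<^sub>R e + (4 * d) *\<^sub>R e"
      by (simp flip: scaleR_add_left)
    then have "reflect e l y\<^sub>0 = x + (4 * d) *\<^sub>R e"
      unfolding reflect_def y\<^sub>0e by (simp add: y\<^sub>0_def)
    then have "dist x (reflect e l y\<^sub>0) = 4 * d"
      using e d by (simp add: dist_norm)
    moreover have "dist (reflect e l y\<^sub>0) (reflect e l y) < d"
      using y by (simp add: dist_reflect[OF e])
    ultimately have "norm (x - reflect e l y) \<le> 5 * d"
      using dist_triangle[of x "reflect e l y" "reflect e l y\<^sub>0"] by (simp add: dist_norm)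
    moreover have "d \<le> norm (x - reflect e l y)"
      using le_norm_diff_reflect[OF e, of y l x] ye[OF y] d by (simp add: d_def)
    ultimately have "1 / (5 * d) powr ?p \<le> kernel x (reflect e l y)"
      unfolding kernel_def using d exponent_pos by (intro divide_left_mono powr_mono2 mult_pos_pos) auto
    then have "2 * c\<^sub>0 * w e l x * kernel x (reflect e l y) \<le> - D"
      unfolding D_def using wx c\<^sub>0
      mult_left_mono[of "1 / (5 * d) powr ?p" "kernel x (reflect e l y)" "- (2 * c\<^sub>0 * w e l x)"]
      by (simp add: mult_nonneg_nonpos)
    moreover have "x \<noteq> y" using y xy d by auto
    ultimately show "G_diff e l x y * kernel x y + G_diff e l x (reflect e l y) * kernel x (reflect e l y) \<le> - D"
      using kernel_sum_le[OF e, of x l y] min[of y] wx ye[OF y] d by (simp add: d_def)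
  qed (use wx d d_def in auto)
  \<comment> \<open>The equation bounds the same difference from the other side, through the growth
    condition on \<open>g\<close>.\<close>
  moreover have "g (u x) - g (u (reflect e l x)) \<le> (- w e l x) * u x powr q"
    using g_diff_le[of "u (reflect e l x)" "u x"] wx u_pos by (simp add: w_def)
  ultimately have "C * (D * (?V * d ^ CARD('n))) \<le> (- w e l x) * u x powr q"
    using d by (simp add: content_ball)
  moreover have "C * (D * (?V * d ^ CARD('n))) = (- w e l x) * (?\<kappa> / d powr \<alpha>)"
    using d by (simp add: D_def powr_mult powr_add powr_realpow mult_ac)
  ultimately have "(- w e l x) * (?\<kappa> / d powr \<alpha>) \<le> (- w e l x) * u x powr q"
    by simp
  then have "?\<kappa> / d powr \<alpha> \<le> u x powr q"
    by (rule mult_left_le_imp_le) (use wx in simp)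
  then show "?\<kappa> \<le> u x powr q * (l - x \<bullet> e) powr \<alpha>"
    using d by (simp add: d_def divide_le_eq mult_ac)
qed

lemma w_plane: "x \<bullet> e = l \<Longrightarrow> w e l x = 0"
  by (simp add: w_def reflect_fixed)

text \<open>At a zero of \<open>w\<close> the right-hand sides of the equation agree at
  \<open>x\<close> and its reflection. A point with positive \<open>w\<close> would make a whole
  ball of pairs contribute strictly negatively, a contradiction.\<close>

lemma strong_maximum_principle:
  assumes e: "norm e = 1" and nonneg: "\<And>z. z \<bullet> e \<le> l \<Longrightarrow> 0 \<le> w e l z"
    and x: "x \<bullet> e < l" "w e l x = 0" and z: "z \<bullet> e \<le> l"
  shows "w e l z = 0"
proof (rule ccontr)
  assume "w e l z \<noteq> 0"
  then have wz: "0 < w e l z" and zl: "z \<bullet> e < l"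
    using nonneg[OF z] w_plane[of z e l] z by fastforce+
  let ?R = "reflect e l"
  define \<psi> where "\<psi> y = G_diff e l x y * kernel x y + G_diff e l x (?R y) * kernel x (?R y)" for y
  \<comment> \<open>Removing \<open>x\<close> removes the singularity, so the pair contribution is
    continuous on \<open>U\<close>.\<close>
  define U where "U = {y. y \<bullet> e < l} - {x}"
  have "open U"
    unfolding U_def using open_halfspace_lt[of e l] by (auto simp: inner_commute)
  have zU: "z \<in> U" using zl x wz by (auto simp: U_def)
  have "continuous_on U \<psi>"
    unfolding \<psi>_def G_diff_def kernel_def reflect_reflect[OF e]
  proof (intro continuous_intros continuous_on_compose2[OF continuous_G[of UNIV]]
        continuous_on_compose2[OF continuous_u[of UNIV]] subset_UNIV ballI)
    fix y assume "y \<in> U"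
    then show "norm (x - y) \<noteq> 0" "norm (x - y) powr (real CARD('n) + \<alpha>) \<noteq> 0"
      "norm (x - ?R y) \<noteq> 0" "norm (x - ?R y) powr (real CARD('n) + \<alpha>) \<noteq> 0"
      using le_norm_diff_reflect[OF e, of y l x] x by (auto simp: U_def)
  qed
  moreover have neg: "\<psi> z < 0"
  proof -
    \<comment> \<open>Since \<open>w e l x = 0\<close>, the two numerators are opposite, and the
      strictly larger kernel goes with the negative one.\<close>
    have "G_diff e l x (?R z) = - G_diff e l x z"
      using x by (simp add: G_diff_def reflect_reflect[OF e] w_def)
    moreover have "G_diff e l x z < 0"
      using x wz by (simp add: G_diff_def w_def G_less)
    moreover have "kernel x (?R z) < kernel x z"
      unfolding kernel_def using norm_diff_reflect_less[OF e x(1) zl] zU exponent_pos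
      by (intro divide_strict_left_mono powr_less_mono2 mult_pos_pos) (auto simp: U_def)
    ultimately have "\<psi> z = G_diff e l x z * (kernel x z - kernel x (?R z))" "G_diff e l x z * (kernel x z - kernel x (?R z)) < 0"
      by (auto simp: \<psi>_def algebra_simps mult_neg_pos)
    then show ?thesis by simp
  qed
  ultimately have "open (U \<inter> \<psi> -` {..<\<psi> z / 2})"
    using \<open>open U\<close> by (intro continuous_open_preimage) auto
  moreover have "z \<in> U \<inter> \<psi> -` {..<\<psi> z / 2}" using zU neg by simp
  ultimately obtain r where r: "0 < r" "ball z r \<subseteq> U \<inter> \<psi> -` {..<\<psi> z / 2}"
    using openE by blast
  \<comment> \<open>Half the distance for both radii keeps the balls around \<open>z\<close> and
    \<open>x\<close> disjoint.\<close>
  define s where "s = dist z x / 2"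
  define r' where "r' = min r s"
  have s: "0 < s" "0 < r'" using zU r by (auto simp: s_def r'_def U_def)
  have r': "ball z r' \<subseteq> U \<inter> \<psi> -` {..<\<psi> z / 2}" using r by (auto simp: r'_def)
  have "g (u (?R x)) - g (u x) \<le> - (C * (- (\<psi> z / 2) * measure lebesgue (ball z r')))"
  proof (rule F_difference_le[OF e x(1) s(1)])
    show "ball z r' \<inter> ball x s = {}"
      by (rule disjoint_ballI) (auto simp: s_def r'_def)
    show "ball z r' \<subseteq> {z. z \<bullet> e < l}" using r' by (auto simp: U_def)
    fix y assume "y \<in> ball z r'"
    then have "\<psi> y < \<psi> z / 2" using r' by auto
    then show "G_diff e l x y * kernel x y + G_diff e l x (?R y) * kernel x (?R y) \<le> - (- (\<psi> z / 2))"
      by (simp add: \<psi>_def)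
  qed (use x nonneg in auto)
  moreover have "0 < C * (- (\<psi> z / 2) * measure lebesgue (ball z r'))"
    using neg C content_ball_pos[OF s(2), of z] by (intro mult_pos_pos) auto
  ultimately show False using x by (simp add: w_def)
qed

section \<open>Decay of the solution; existence and location of negative minima\<close>

lemma u_decay_bound:
  assumes "0 < \<eta>"
  obtains R where "1 \<le> R" "\<And>x. R \<le> norm x \<Longrightarrow> u x \<le> \<eta> / norm x powr \<gamma>"
proof -
  have "eventually (\<lambda>x. norm (u x) \<le> \<eta> * norm (1 / norm x powr \<gamma>)) at_infinity"
    by (rule landau_o.smallD[OF u_decay assms])
  then obtain b where b: "\<And>x. b \<le> norm x \<Longrightarrow> norm (u x) \<le> \<eta> * norm (1 / norm x powr \<gamma>)"
    unfolding eventually_at_infinity by blast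
  show ?thesis
  proof (rule that[of "max 1 b"])
    fix x :: "real ^ 'n" assume "max 1 b \<le> norm x"
    then show "u x \<le> \<eta> / norm x powr \<gamma>" using b[of x] u_pos[of x] by simp
  qed simp
qed

lemma u_small:
  assumes "0 < \<eta>"
  obtains R where "1 \<le> R" "\<And>x. R \<le> norm x \<Longrightarrow> u x \<le> \<eta>"
proof -
  obtain R where R: "1 \<le> R" "\<And>x. R \<le> norm x \<Longrightarrow> u x \<le> \<eta> / norm x powr \<gamma>"
    by (rule u_decay_bound[OF assms]) blast
  show ?thesis
  proof (rule that[OF R(1)])
    fix x :: "real ^ 'n" assume x: "R \<le> norm x"
    then have "1 \<le> norm x powr \<gamma>" using R(1) \<gamma> by (intro ge_one_powr_ge_zero) auto
    then have "\<eta> / norm x powr \<gamma> \<le> \<eta> / 1"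
      using assms by (intro divide_left_mono) auto
    then show "u x \<le> \<eta>" using R(2)[OF x] by simp
  qed
qed

lemma u_bounded:
  obtains B where "0 < B" "\<And>x. u x \<le> B"
proof -
  obtain R where R: "1 \<le> R" "\<And>x. R \<le> norm x \<Longrightarrow> u x \<le> 1"
    using u_small[of 1] by auto
  have "bounded (u ` cball 0 R)"
    by (intro compact_imp_bounded compact_continuous_image continuous_u) auto
  then obtain b where b: "0 < b" "\<And>x. norm x \<le> R \<Longrightarrow> \<bar>u x\<bar> \<le> b"
    unfolding bounded_pos by auto
  show ?thesis
  proof (rule that[of "max 1 b"])
    show "u x \<le> max 1 b" for x
      using R(2)[of x] b(2)[of x] by (cases "R \<le> norm x") auto
  qed simp
qed

lemma continuous_w: "continuous_on S (\<lambda>x. w e l x)"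
  unfolding w_def
  by (intro continuous_intros continuous_on_compose2[OF continuous_u[of UNIV]]) auto

text \<open>Since \<open>w\<close> exceeds \<open>- u\<close> and \<open>u\<close> decays, values
  outside a large ball stay above the given negative one. The minimum over the compact part is thus
  global, and it is off the plane, where \<open>w\<close> vanishes.\<close>

lemma neg_min_exists:
  assumes "z \<bullet> e \<le> l" "w e l z < 0"
  obtains x where "neg_min e l x"
proof -
  obtain R where R: "\<And>x. R \<le> norm x \<Longrightarrow> u x \<le> - w e l z / 2"
    using u_small[of "- w e l z / 2"] assms by auto
  let ?K = "cball 0 (max R (norm z)) \<inter> {y. y \<bullet> e \<le> l}"
  have "compact ?K"
    using closed_halfspace_le[of e l] by (intro compact_Int_closed) (auto simp: inner_commute)
  moreover have zK: "z \<in> ?K" using assms by simp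
  ultimately obtain x where x: "x \<in> ?K" "\<And>y. y \<in> ?K \<Longrightarrow> w e l x \<le> w e l y"
    using continuous_attains_inf[of ?K "w e l"] continuous_w by (metis empty_iff)
  have neg: "w e l x < 0" using x(2)[OF zK] assms by simp
  have "w e l x \<le> w e l y" if y: "y \<bullet> e \<le> l" for y
  proof (cases "y \<in> ?K")
    case False
    then have "u y \<le> - w e l z / 2" using y by (intro R) auto
    then have "w e l z \<le> w e l y"
      using u_pos[of "reflect e l y"] assms by (simp add: w_def)
    then show ?thesis using x(2)[OF zK] by simp
  qed (rule x)
  moreover have "x \<bullet> e \<noteq> l" using neg w_plane[of x e l] by auto
  ultimately show ?thesis using that x(1) neg unfolding neg_min_def by force
qed

text \<open>If \<open>x\<close> is far out and its distance to the plane is at most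
  \<open>2 * norm x\<close>, decay with \<open>q * \<gamma> \<ge> \<alpha>\<close> violates the
  bound on negative minima; if it is too close to the plane, boundedness of \<open>u\<close> does.
  \<open>R\<close> and \<open>\<delta>\<close> serve all directions and planes.\<close>

lemma neg_min_location:
  "\<exists>R>0. \<exists>\<delta>>0. \<forall>e l x. norm e = 1 \<longrightarrow> neg_min e l x \<longrightarrow>
    (norm x < R \<or> 2 * norm x < l - x \<bullet> e) \<and> \<delta> \<le> l - x \<bullet> e"
proof -
  obtain \<kappa> where \<kappa>: "0 < \<kappa>"
    "\<And>e l x. norm e = 1 \<Longrightarrow> neg_min e l x \<Longrightarrow> \<kappa> \<le> u x powr q * (l - x \<bullet> e) powr \<alpha>"
    by (rule neg_min_bound) blast
  obtain B where B: "0 < B" "\<And>x. u x \<le> B" by (rule u_bounded) blast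
  \<comment> \<open>Chosen so that \<open>\<eta> powr q * 2 powr \<alpha>\<close> is half of
    \<open>\<kappa>\<close>.\<close>
  define \<eta> where "\<eta> = (\<kappa> / (2 * 2 powr \<alpha>)) powr (1 / q)"
  have \<eta>: "0 < \<eta>" "\<eta> powr q = \<kappa> / (2 * 2 powr \<alpha>)"
    using \<kappa>(1) q_pos by (auto simp: \<eta>_def powr_powr)
  obtain R where R: "1 \<le> R" "\<And>x. R \<le> norm x \<Longrightarrow> u x \<le> \<eta> / norm x powr \<gamma>"
    by (rule u_decay_bound[OF \<eta>(1)]) blast
  \<comment> \<open>The distance at which \<open>B powr q * \<delta> powr \<alpha>\<close> equals
    \<open>\<kappa>\<close>.\<close>
  define \<delta> where "\<delta> = (\<kappa> / B powr q) powr (1 / \<alpha>)"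
  have \<delta>: "0 < \<delta>" "\<delta> powr \<alpha> = \<kappa> / B powr q"
    using \<kappa>(1) \<alpha> B by (auto simp: \<delta>_def powr_powr)
  show ?thesis
  proof (intro exI conjI allI impI)
    show "0 < R" "0 < \<delta>" using R \<delta> by auto
    fix e l x assume e: "norm e = 1" and nm: "neg_min e l x"
    have d: "0 < l - x \<bullet> e" using nm by (simp add: neg_min_def)
    show "norm x < R \<or> 2 * norm x < l - x \<bullet> e"
    proof (rule ccontr)
      assume "\<not> ?thesis"
      then have x: "R \<le> norm x" and dx: "l - x \<bullet> e \<le> 2 * norm x" by auto
      have nx: "1 \<le> norm x" using R(1) x by simp
      have "u x powr q \<le> (\<eta> / norm x powr \<gamma>) powr q"
        using R(2)[OF x] u_pos[of x] q_pos by (intro powr_mono2) auto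
      also have "\<dots> = \<eta> powr q / norm x powr (q * \<gamma>)"
        using \<eta>(1) by (simp add: powr_divide powr_powr mult.commute)
      also have "\<dots> \<le> \<eta> powr q / norm x powr \<alpha>"
        using nx q by (intro divide_left_mono powr_mono mult_pos_pos) auto
      finally have 1: "u x powr q \<le> \<eta> powr q / norm x powr \<alpha>" .
      have 2: "(l - x \<bullet> e) powr \<alpha> \<le> 2 powr \<alpha> * norm x powr \<alpha>"
        using dx d \<alpha> powr_mono2[of \<alpha> "l - x \<bullet> e" "2 * norm x"] by (simp add: powr_mult)
      have "\<kappa> \<le> u x powr q * (l - x \<bullet> e) powr \<alpha>" by (rule \<kappa>(2)[OF e nm])
      also have "\<dots> \<le> \<eta> powr q / norm x powr \<alpha> * (2 powr \<alpha> * norm x powr \<alpha>)"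
        by (intro mult_mono 1 2) auto
      also have "\<dots> = \<kappa> / 2" using nx by (cases "x = 0") (simp_all add: \<eta>(2) field_simps)
      finally show False using \<kappa>(1) by simp
    qed
    show "\<delta> \<le> l - x \<bullet> e"
    proof (rule ccontr)
      assume "\<not> ?thesis"
      then have "(l - x \<bullet> e) powr \<alpha> < \<delta> powr \<alpha>" using d \<alpha> by (intro powr_less_mono2) auto
      then have "B powr q * (l - x \<bullet> e) powr \<alpha> < B powr q * \<delta> powr \<alpha>"
        using B(1) by (intro mult_strict_left_mono) auto
      also have "\<dots> = \<kappa>" using \<delta>(2) B(1) by simp
      also have "\<dots> \<le> u x powr q * (l - x \<bullet> e) powr \<alpha>" by (rule \<kappa>(2)[OF e nm])
      also have "\<dots> \<le> B powr q * (l - x \<bullet> e) powr \<alpha>"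
        using B(2)[of x] u_pos[of x] q_pos by (intro mult_right_mono powr_mono2) auto
      finally show False by simp
    qed
  qed
qed

section \<open>Moving the plane in a fixed direction\<close>

lemma symmetric_about_hyperplane:
  assumes e: "norm e = 1"
  shows "\<exists>l. \<forall>z. u (reflect e l z) = u z"
proof -
  obtain R \<delta> where R: "0 < R" and \<delta>: "0 < \<delta>"
    and "\<forall>e l x. norm e = 1 \<longrightarrow> neg_min e l x \<longrightarrow>
      (norm x < R \<or> 2 * norm x < l - x \<bullet> e) \<and> \<delta> \<le> l - x \<bullet> e"
    using neg_min_location by blast
  then have loc: "norm x < R \<or> 2 * norm x < l - x \<bullet> e" and gap: "\<delta> \<le> l - x \<bullet> e"
    if "neg_min e l x" for l x
    using that e by blast+
  have xe: "\<bar>x \<bullet> e\<bar> \<le> norm x" for x using Cauchy_Schwarz_ineq2[of x e] e by simp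
  define S where "S = {l. \<forall>z. z \<bullet> e \<le> l \<longrightarrow> 0 \<le> w e l z}"
  have negS: "\<exists>x. neg_min e l x" if l: "l \<notin> S" for l
  proof -
    obtain z where "z \<bullet> e \<le> l" "w e l z < 0" using l by (auto simp: S_def not_le)
    then show ?thesis by (rule neg_min_exists) (rule exI)
  qed
  \<comment> \<open>Starting position: before this plane \<open>norm x\<close> exceeds
    \<open>R\<close>, while the distance to the plane is less than \<open>norm x\<close>, so both
    alternatives for a negative minimum fail.\<close>
  have "- R \<in> S"
  proof (rule ccontr)
    assume "- R \<notin> S"
    then obtain x where x: "neg_min e (- R) x" using negS by blast
    then have "x \<bullet> e < - R" by (simp add: neg_min_def)
    then show False using loc[OF x] xe[of x] R by auto
  qed
  \<comment> \<open>The plane cannot move on forever: the origin would reflect to a point where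
    \<open>u\<close> is at most half of \<open>u 0\<close>.\<close>
  obtain R' where R': "1 \<le> R'" "\<And>x. R' \<le> norm x \<Longrightarrow> u x \<le> u 0 / 2"
    using u_small[of "u 0 / 2"] u_pos[of 0] by auto
  have bdd: "l \<le> R'" if "l \<in> S" for l
  proof (rule ccontr)
    assume l: "\<not> l \<le> R'"
    then have "0 \<le> w e l 0" using that R'(1) by (simp add: S_def)
    moreover have "u (reflect e l 0) \<le> u 0 / 2"
      using l R'(1) e by (intro R') (simp add: reflect_def)
    ultimately show False using u_pos[of 0] by (simp add: w_def)
  qed
  define \<Lambda> where "\<Lambda> = Sup S"
  have upper: "l \<le> \<Lambda>" if "l \<in> S" for l
    unfolding \<Lambda>_def by (rule cSup_upper[OF that]) (use bdd in \<open>auto simp: bdd_above_def\<close>)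
  have w_tendsto: "((\<lambda>i. w e (f i) (h i)) \<longlongrightarrow> w e a b) F"
    if "(f \<longlongrightarrow> a) F" "(h \<longlongrightarrow> b) F" for f h a b and F :: "'b filter"
  proof -
    have iso: "isCont u y" for y
      using continuous_u[of UNIV] by (simp add: continuous_on_eq_continuous_at)
    show ?thesis
      unfolding w_def reflect_def
      by (intro tendsto_intros isCont_tendsto_compose[OF iso] that)
  qed
  \<comment> \<open>The limiting position still belongs to \<open>S\<close>: a negative value would
    persist for planes slightly to the left, arbitrarily close to the supremum.\<close>
  have \<Lambda>: "0 \<le> w e \<Lambda> z" if z: "z \<bullet> e \<le> \<Lambda>" for z
  proof (rule ccontr)
    assume neg: "\<not> ?thesis"
    then have zl: "z \<bullet> e < \<Lambda>" using w_plane[of z e \<Lambda>] z by force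
    have "((\<lambda>l. w e l z) \<longlongrightarrow> w e \<Lambda> z) (at_left \<Lambda>)"
      by (rule w_tendsto) auto
    then have "eventually (\<lambda>l. w e l z < 0) (at_left \<Lambda>)"
      using neg by (intro order_tendstoD(2)) auto
    then obtain b where b: "b < \<Lambda>" "\<And>l. b < l \<Longrightarrow> l < \<Lambda> \<Longrightarrow> w e l z < 0"
      unfolding eventually_at_left_field by blast
    obtain l where l: "l \<in> S" "max b (z \<bullet> e) < l"
      using less_cSupD[of S "max b (z \<bullet> e)"] \<open>- R \<in> S\<close> b zl unfolding \<Lambda>_def by auto
    then have "w e l z < 0"
      using b(2)[of l] upper[of l] neg by (cases "l = \<Lambda>") auto
    moreover have "0 \<le> w e l z" using l unfolding S_def by simp
    ultimately show False by simp
  qed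
  have zero: "w e \<Lambda> z = 0" if "z \<bullet> e \<le> \<Lambda>" for z
  proof (rule ccontr)
    assume nz: "w e \<Lambda> z \<noteq> 0"
    have pos: "0 < w e \<Lambda> x" if "x \<bullet> e < \<Lambda>" for x
      using strong_maximum_principle[OF e \<Lambda> that _ \<open>z \<bullet> e \<le> \<Lambda>\<close>] nz \<Lambda>[of x] that by fastforce
    \<comment> \<open>Planes just beyond the supremum, each with a negative minimum.\<close>
    define l where "l n = \<Lambda> + 1 / real (Suc n)" for n
    have "l n \<notin> S" for n using upper[of "l n"] by (auto simp: l_def)
    then have "\<exists>x. \<forall>n. neg_min e (l n) (x n)"
      by (intro choice allI negS)
    then obtain x where "\<forall>n. neg_min e (l n) (x n)" by (rule exE)
    then have x: "neg_min e (l n) (x n)" for n by (rule spec)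
    \<comment> \<open>The alternative \<open>2 * norm x < l - x \<bullet> e\<close> forces
      \<open>norm x < l\<close>, so all the minima lie in one ball.\<close>
    define B where "B = max R (\<bar>\<Lambda>\<bar> + 1)"
    have "x n \<in> cball 0 B" for n
    proof -
      have "l n \<le> \<bar>\<Lambda>\<bar> + 1" by (simp add: l_def add_mono)
      then show ?thesis using loc[OF x[of n]] xe[of "x n"] by (auto simp: B_def)
    qed
    then obtain y r where r: "strict_mono r" "(x \<circ> r) \<longlonglongrightarrow> y"
      using compact_cball[of 0 B] unfolding compact_def by metis
    have "l \<longlonglongrightarrow> \<Lambda> + 0"
      unfolding l_def using LIMSEQ_inverse_real_of_nat
      by (intro tendsto_intros) (simp add: inverse_eq_divide)
    then have l: "(l \<circ> r) \<longlonglongrightarrow> \<Lambda>" using LIMSEQ_subseq_LIMSEQ[OF _ r(1)] by simp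
    have "w e \<Lambda> y \<le> 0"
      by (rule tendsto_upperbound[OF w_tendsto[OF l r(2)]])
        (use x in \<open>auto simp: neg_min_def intro!: always_eventually less_imp_le\<close>)
    \<comment> \<open>The uniform gap survives the limit, so \<open>y\<close> is interior, where
      \<open>w\<close> is positive.\<close>
    moreover have "\<delta> \<le> \<Lambda> - y \<bullet> e"
      by (rule tendsto_lowerbound[OF tendsto_diff[OF l tendsto_inner[OF r(2) tendsto_const]]])
        (use gap[OF x] in auto)
    ultimately show False using pos[of y] \<delta> by simp
  qed
  have "u (reflect e \<Lambda> z) = u z" for z
  proof (cases "z \<bullet> e \<le> \<Lambda>")
    case True then show ?thesis using zero[of z] by (simp add: w_def)
  next
    case False
    then have "reflect e \<Lambda> z \<bullet> e \<le> \<Lambda>" using inner_reflect[OF e, of \<Lambda> z] by simp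
    from zero[OF this] show ?thesis by (simp add: w_def reflect_reflect[OF e])
  qed
  then show ?thesis by blast
qed

subsection \<open>Radial symmetry\<close>

text \<open>Iterating a nonzero period carries the value \<open>u 0\<close> to infinity, against the
  decay of \<open>u\<close>.\<close>

lemma not_periodic:
  assumes "\<And>x. u (x + v) = u x"
  shows "v = 0"
proof (rule ccontr)
  assume v: "v \<noteq> 0"
  have period: "u (real n *\<^sub>R v) = u 0" for n
  proof (induction n)
    case (Suc n)
    then show ?case using assms[of "real n *\<^sub>R v"] by (simp add: algebra_simps)
  qed simp
  obtain R where R: "\<And>x. R \<le> norm x \<Longrightarrow> u x \<le> u 0 / 2"
    using u_small[of "u 0 / 2"] u_pos[of 0] by auto
  obtain n where "R / norm v \<le> real n" using real_arch_simple by blast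
  then have "R \<le> norm (real n *\<^sub>R v)" using v by (simp add: divide_le_eq)
  then show False using R[of "real n *\<^sub>R v"] period[of n] u_pos[of 0] by simp
qed

text \<open>The coordinate reflections compose to the point reflection at \<open>p\<close>; this
  forces every plane of symmetry through \<open>p\<close>, and reflections in planes through
  \<open>p\<close> exchange any two points equidistant from it.\<close>

lemma radial: "\<exists>p. radially_symmetric_about u p"
proof -
  obtain L where L: "\<And>e z. norm e = 1 \<Longrightarrow> u (reflect e (L e) z) = u z"
    using symmetric_about_hyperplane by metis
  define p :: "real ^ 'n" where "p = (\<Sum>b\<in>Basis. L b *\<^sub>R b)"
  \<comment> \<open>Reflections in orthogonal directions do not disturb each other's coordinates, so
    they can be applied one basis vector at a time.\<close>
  have refl_B: "u (x - (\<Sum>b\<in>B. (2 * (x \<bullet> b - L b)) *\<^sub>R b)) = u x" if "B \<subseteq> Basis" for B x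
    using finite_subset[OF that finite_Basis] that
  proof (induction B rule: finite_induct)
    case (insert b B)
    let ?y = "x - (\<Sum>b\<in>B. (2 * (x \<bullet> b - L b)) *\<^sub>R b)"
    have "(\<Sum>c\<in>B. (2 * (x \<bullet> c - L c)) * (c \<bullet> b)) = 0"
    proof (intro sum.neutral ballI)
      fix c assume "c \<in> B"
      then have "c \<bullet> b = 0" using insert by (intro inner_not_same_Basis) auto
      then show "(2 * (x \<bullet> c - L c)) * (c \<bullet> b) = 0" by simp
    qed
    then have "?y \<bullet> b = x \<bullet> b"
      by (simp add: inner_diff_left inner_sum_left)
    then have "reflect b (L b) ?y = x - (\<Sum>b\<in>insert b B. (2 * (x \<bullet> b - L b)) *\<^sub>R b)"
      using insert by (simp add: reflect_def)
    then show ?case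
      using L[of b ?y] insert by (simp add: norm_Basis)
  qed simp
  have center: "u (2 *\<^sub>R p - x) = u x" for x
  proof -
    have "x - (\<Sum>b\<in>Basis. (2 * (x \<bullet> b - L b)) *\<^sub>R b)
        = x - (2 *\<^sub>R (\<Sum>b\<in>Basis. (x \<bullet> b) *\<^sub>R b) - 2 *\<^sub>R p)"
      by (simp add: p_def scaleR_sum_right right_diff_distrib scaleR_diff_left sum_subtractf)
    also have "\<dots> = 2 *\<^sub>R p - x"
      by (simp add: euclidean_representation scaleR_2)
    finally show ?thesis using refl_B[OF order_refl, of x] by (simp only:)
  qed
  have L_eq: "L e = p \<bullet> e" if e: "norm e = 1" for e
  proof -
    let ?R = "reflect e (L e)"
    \<comment> \<open>Two rounds of point reflection at \<open>p\<close> followed by plane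
      reflection make a translation along \<open>e\<close>, by four times the offset of the plane
      from \<open>p\<close>.\<close>
    have "u (x + (4 * (L e - p \<bullet> e)) *\<^sub>R e) = u x" for x
    proof -
      have "?R (2 *\<^sub>R p - ?R (2 *\<^sub>R p - x)) = x + (4 * (L e - p \<bullet> e)) *\<^sub>R e"
      proof -
        have "?R (2 *\<^sub>R p - x) = 2 *\<^sub>R p - x - (2 * (2 * (p \<bullet> e) - x \<bullet> e - L e)) *\<^sub>R e"
          by (simp add: reflect_def inner_diff_left)
        then have 1: "2 *\<^sub>R p - ?R (2 *\<^sub>R p - x) = x + (2 * (2 * (p \<bullet> e) - x \<bullet> e - L e)) *\<^sub>R e"
          by simp
        have 2: "(2 *\<^sub>R p - ?R (2 *\<^sub>R p - x)) \<bullet> e = 4 * (p \<bullet> e) - x \<bullet> e - 2 * L e"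
          unfolding 1 using inner_unit[OF e] by (simp add: inner_add_left)
        have "(2 * (2 * (p \<bullet> e) - x \<bullet> e - L e)) *\<^sub>R e
            - (2 * (4 * (p \<bullet> e) - x \<bullet> e - 2 * L e - L e)) *\<^sub>R e = (4 * (L e - p \<bullet> e)) *\<^sub>R e"
          unfolding scaleR_diff_left[symmetric] by (rule arg_cong[of _ _ "\<lambda>t. t *\<^sub>R e"]) simp
        then show ?thesis
          unfolding reflect_def[of e "L e" "2 *\<^sub>R p - ?R (2 *\<^sub>R p - x)"] 2 unfolding 1
          by (simp only: add_diff_eq[symmetric])
      qed
      then show ?thesis
        using L[OF e, of "2 *\<^sub>R p - ?R (2 *\<^sub>R p - x)"] L[OF e, of "2 *\<^sub>R p - x"]
          center[of "?R (2 *\<^sub>R p - x)"] center[of x] by simp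
    qed
    then have "(4 * (L e - p \<bullet> e)) *\<^sub>R e = 0" by (rule not_periodic)
    then show ?thesis using e by auto
  qed
  have u_eq: "u x = u y" if xy: "norm (x - p) = norm (y - p)" for x y
  proof (cases "x = y")
    case False
    define N where "N = norm (x - y)"
    \<comment> \<open>Unit normal of the perpendicular bisector of \<open>x\<close> and
      \<open>y\<close>, which contains \<open>p\<close> by equidistance.\<close>
    define e where "e = (1 / N) *\<^sub>R (x - y)"
    have N: "0 < N" using False by (simp add: N_def)
    have e: "norm e = 1" using N by (simp add: e_def N_def)
    have "(x - p) \<bullet> (x - p) = (y - p) \<bullet> (y - p)"
      using xy by (metis power2_norm_eq_inner)
    then have "2 * ((x - p) \<bullet> (x - y)) = (x - y) \<bullet> (x - y)"
      by (simp add: inner_diff_left inner_diff_right inner_commute)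
    also have "\<dots> = N * N" by (simp add: N_def power2_norm_eq_inner[symmetric] power2_eq_square)
    finally have "2 * ((x - p) \<bullet> (x - y)) = N * N" .
    moreover have "(x - p) \<bullet> e = (1 / N) * ((x - p) \<bullet> (x - y))"
      by (simp only: e_def inner_scaleR_right)
    ultimately have "2 * (x \<bullet> e - p \<bullet> e) = N"
      using N by (simp add: inner_diff_left[symmetric])
    then have "reflect e (p \<bullet> e) x = x - N *\<^sub>R e" by (simp add: reflect_def)
    also have "\<dots> = y" using N by (simp add: e_def)
    finally show ?thesis using L[OF e, of x] L_eq[OF e] by simp
  qed simp
  \<comment> \<open>The profile is read off at an arbitrary point of each sphere; \<open>x\<close>
    itself shows that the choice is from a nonempty set.\<close>
  have "u x = u (SOME y. norm (y - p) = norm (x - p))" for x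
    by (rule u_eq, rule sym) (rule someI[of "\<lambda>y. norm (y - p) = norm (x - p)" x], simp)
  then have "radially_symmetric_about u p"
    unfolding radially_symmetric_about_def
    by (intro exI[of _ "\<lambda>r. u (SOME y. norm (y - p) = r)"]) blast
  then show ?thesis by blast
qed

end

theorem theorem5:
  fixes u :: "real ^ 'n \<Rightarrow> real"
    and G g :: "real \<Rightarrow> real"
    and \<alpha> c\<^sub>0 C \<gamma> q :: real
  assumes "0 < \<alpha>" and "\<alpha> < 2"
    and "0 < C"
    and "G C1_differentiable_on UNIV"
    and "G 0 = 0"
    and "0 < c\<^sub>0" and "\<And>t. deriv G t \<ge> c\<^sub>0"
    and "C11_loc u"
    and "u \<in> L_space \<alpha>"
    and "\<And>x. 0 < u x"
    and "\<And>x. F_op_exists G \<alpha> u x"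
    and "\<And>x. F_op C G \<alpha> u x = g (u x)"
    and "g differentiable_on {0<..}"
    and "0 < \<gamma>"
    and "u \<in> o[at_infinity](\<lambda>x. 1 / norm x powr \<gamma>)"
    and "\<And>s. 0 < s \<Longrightarrow> deriv g s \<le> s powr q"
    and "q * \<gamma> \<ge> \<alpha>"
  shows "\<exists>p. radially_symmetric_about u p"
proof -
  interpret fully_nonlinear_solution u G g \<alpha> c\<^sub>0 C \<gamma> q
    by unfold_locales (use assms in auto)
  show ?thesis by (rule radial)
qed

end
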